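(* The poset $\mathcal{W}$ has the following properties: (1) $\mathcal{W}$ contains an antichain of cardinality $2^{\mathfrak{c}}$; (2) $\mathcal{W}$ contains a well-ordered chain of cardinality $\mathfrak{c}$; (3) $|\mathcal{W}|=|\mathcal{SCT}|=2^{\mathfrak{c}}$.
   Context: All topologies are assumed Hausdorff. $\omega$ is the set of non-negative integers, $\mathfrak{c}=2^{\omega}$ is the cardinality of the continuum. The bicyclic monoid $\mathcal{C}$ is the set $\omega\times\omega$ with the operation $(a,b)\cdot(c,d)=(a+c-b,d)$ if $b\le c$ and $(a,b)\cdot(c,d)=(a,d+b-c)$ if $b>c$. $\mathcal{C}^0=\mathcal{C}\cup\{0\}$ is $\mathcal{C}$ with an adjoined zero $0$. A topology on a semigroup is shift-continuous if the semigroup operation is separately continuous. $\mathcal{SCT}$ is the set of all Hausdorff shift-continuous topologies on $\mathcal{C}^0$, ordered by inclusion. The topology $\tau_{\min}$ on $\mathcal{C}^0$ (the coarsest Hausdorff topology making $\mathcal{C}^0$ a topological inverse semigroup) is the one in which all elements of $\mathcal{C}$ are isolated and the sets $C_n=\{0\}\cup\{(k,m)\mid k,m>n\}$, $n\in\omega$, form an open neighborhood base at $0$. A Hausdorff topology $\tau$ on $\mathcal{C}^0$ is weak if $\tau\subseteq\tau_{\min}$. $\mathcal{W}\subseteq\mathcal{SCT}$ is the set of all weak Hausdorff shift-continuous topologies on $\mathcal{C}^0$, ordered by inclusion. An antichain is a subset in which any two distinct elements are incomparable. *)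

theory Defs
  imports "HOL-Analysis.Analysis" "HOL-Library.Equipollence"
begin

fun bicyclic_mult :: "nat \<times> nat \<Rightarrow> nat \<times> nat \<Rightarrow> nat \<times> nat" where
  "bicyclic_mult (a, b) (c, d) = (if b \<le> c then (a + c - b, d) else (a, d + b - c))"

text \<open>The adjoined zero is \<^term>\<open>None\<close>.\<close>

type_synonym bicyclic0 = "(nat \<times> nat) option"

fun bicyclic0_mult :: "bicyclic0 \<Rightarrow> bicyclic0 \<Rightarrow> bicyclic0"  (infixl "\<odot>" 70) where
  "Some x \<odot> Some y = Some (bicyclic_mult x y)"
| "None \<odot> y = None"
| "x \<odot> None = None"

lemma bicyclic0_mult_assoc: "(x \<odot> y) \<odot> z = x \<odot> (y \<odot> z)"
  by (cases x; cases y; cases z) auto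

definition shift_continuous :: "bicyclic0 topology \<Rightarrow> bool" where
  "shift_continuous T \<longleftrightarrow>
     (\<forall>a. continuous_map T T (\<lambda>x. a \<odot> x) \<and> continuous_map T T (\<lambda>x. x \<odot> a))"

definition SCT :: "bicyclic0 topology set" where
  "SCT = {T. topspace T = UNIV \<and> Hausdorff_space T \<and> shift_continuous T}"

definition topology_le :: "'a topology \<Rightarrow> 'a topology \<Rightarrow> bool"  (infix "\<sqsubseteq>\<^sub>t" 50) where
  "S \<sqsubseteq>\<^sub>t T \<longleftrightarrow> {U. openin S U} \<subseteq> {U. openin T U}"

definition zero_nhd :: "nat \<Rightarrow> bicyclic0 set" where
  "zero_nhd n = {None} \<union> {Some (k, m) | k m. k > n \<and> m > n}"

definition tau_min :: "bicyclic0 topology" where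
  "tau_min = topology (\<lambda>U. None \<in> U \<longrightarrow> (\<exists>n. zero_nhd n \<subseteq> U))"

text \<open>
  \<^const>\<open>topology\<close> is only meaningful on predicates satisfying \<^const>\<open>istopology\<close>.
  The following facts show that this is the case here, that the nonzero elements are isolated,
  and that the sets \<^const>\<open>zero_nhd\<close> form an open neighborhood base at zero.
\<close>

lemma openin_tau_min: "openin tau_min U \<longleftrightarrow> (None \<in> U \<longrightarrow> (\<exists>n. zero_nhd n \<subseteq> U))"
proof -
  have mono: "zero_nhd n \<subseteq> zero_nhd m" if "m \<le> n" for m n
    using that by (auto simp: zero_nhd_def)
  have "istopology (\<lambda>U. None \<in> U \<longrightarrow> (\<exists>n. zero_nhd n \<subseteq> U))"
    unfolding istopology_def
  proof (intro conjI allI impI)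
    fix S T :: "bicyclic0 set"
    assume S: "None \<in> S \<longrightarrow> (\<exists>n. zero_nhd n \<subseteq> S)"
      and T: "None \<in> T \<longrightarrow> (\<exists>n. zero_nhd n \<subseteq> T)" and "None \<in> S \<inter> T"
    then obtain m n where "zero_nhd m \<subseteq> S" "zero_nhd n \<subseteq> T"
      by auto
    then have "zero_nhd (max m n) \<subseteq> S \<inter> T"
      using mono[of m "max m n"] mono[of n "max m n"] by auto
    then show "\<exists>n. zero_nhd n \<subseteq> S \<inter> T" ..
  next
    fix K :: "bicyclic0 set set"
    assume "\<forall>S\<in>K. None \<in> S \<longrightarrow> (\<exists>n. zero_nhd n \<subseteq> S)" and "None \<in> \<Union>K"
    then show "\<exists>n. zero_nhd n \<subseteq> \<Union>K"
      by (meson UnionE Union_upper subset_trans)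
  qed
  then show ?thesis
    by (simp add: tau_min_def topology_inverse')
qed

lemma topspace_tau_min: "topspace tau_min = UNIV"
proof -
  have "openin tau_min UNIV"
    by (simp add: openin_tau_min)
  then show ?thesis
    by (simp add: openin_subset top.extremum_uniqueI)
qed

lemma openin_tau_min_singleton: "openin tau_min {Some x}"
  by (simp add: openin_tau_min)

lemma openin_tau_min_zero_nhd: "openin tau_min (zero_nhd n)"
  by (auto simp: openin_tau_min)

lemma tau_min_nhd_base:
  assumes "openin tau_min U" and "None \<in> U"
  shows "\<exists>n. None \<in> zero_nhd n \<and> zero_nhd n \<subseteq> U"
  using assms by (auto simp: openin_tau_min zero_nhd_def)

definition weak_SCT :: "bicyclic0 topology set"  ("\<W>") where
  "\<W> = {T \<in> SCT. T \<sqsubseteq>\<^sub>t tau_min}"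

definition topology_antichain :: "'a topology set \<Rightarrow> bool" where
  "topology_antichain A \<longleftrightarrow>
     (\<forall>S\<in>A. \<forall>T\<in>A. S \<noteq> T \<longrightarrow> \<not> S \<sqsubseteq>\<^sub>t T \<and> \<not> T \<sqsubseteq>\<^sub>t S)"

text \<open>\<^const>\<open>well_order_on\<close> includes linearity, so a well-ordered subset is in particular a chain.\<close>

definition topology_well_ordered_chain :: "'a topology set \<Rightarrow> bool" where
  "topology_well_ordered_chain A \<longleftrightarrow>
     well_order_on A {(S, T). S \<in> A \<and> T \<in> A \<and> S \<sqsubseteq>\<^sub>t T}"

text \<open>Sets whose cardinalities are the continuum \<open>2\<^sup>\<omega>\<close> and \<open>2\<close> to the continuum.\<close>

definition continuum :: "nat set set" where
  "continuum = Pow UNIV"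

definition pow_continuum :: "nat set set set" where
  "pow_continuum = Pow continuum"

end

theory Submission
  imports Defs
begin

text \<open>
  The nonzero elements may all be taken isolated, so a topology is given by its neighbourhood
  filter at zero. View \<^term>\<open>Some (k, m)\<close> as the entry in row \<open>k\<close> and column \<open>m\<close>. From a
  filter \<open>F\<close> on the column indices one gets a topology in which a neighbourhood of zero contains
  all rows from some point on, and in each of the remaining rows an \<open>F\<close>-large set. A translation
  of the bicyclic monoid moves rows around and, along a row, acts for large columns as
  an ordinary shift of the column index. Hence the topology is shift-continuous as soon as
  \<open>F\<close> is free and invariant under shifts. It is weak because all rows
  beyond \<open>n\<close> together contain \<^term>\<open>zero_nhd n\<close>
  (\<open>row_topology_in_weak_SCT\<close>). The inclusion of such topologies is the inclusion of the filters
  (\<open>row_topology_le_iff\<close>).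

  So it suffices to find many shift-invariant free filters. Take an almost disjoint family of
  continuum many sets \<open>sparse_branch Y\<close> of natural numbers, all lying inside the squares. Since the
  gaps between squares tend to infinity, even arbitrary shifts of two different members are almost
  disjoint. For a set \<open>S\<close> of indices, let \<open>F\<^sub>S\<close> be the filter of sets
  whose complement is covered by a finite set and finitely many shifts of sets \<open>sparse_branch Y\<close>
  with \<open>Y \<in> S\<close>. No \<open>sparse_branch Z\<close> with \<open>Z \<notin> S\<close> is covered in this way, so \<open>S \<mapsto> F\<^sub>S\<close> embeds the whole
  power set of a set of size continuum, ordered by inclusion, into the weak topologies
  (\<open>weak_topology_le_iff\<close>).

  All three claims are then statements about the power set of a set \<open>X\<close> of size continuum: it has an
  antichain as large as itself, obtained by splitting \<open>X\<close> into two copies and sending \<open>S\<close> to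
  \<open>S\<close> in one copy together with its complement in the other; and it has a well-ordered chain
  as large as \<open>X\<close>, namely the initial segments of a well-order on \<open>X\<close>. The upper bound in the
  last claim holds because a topology on a countable set is a set of subsets of a countable set.
\<close>

section \<open>Topologies from filters on the columns\<close>

definition row_topology :: "nat filter \<Rightarrow> bicyclic0 topology" where
  "row_topology F = topology (\<lambda>U. None \<in> U \<longrightarrow>
     (\<exists>n. \<forall>k>n. \<forall>m. Some (k, m) \<in> U) \<and> (\<forall>k. \<forall>\<^sub>F m in F. Some (k, m) \<in> U))"

lemma openin_row_topology:
  "openin (row_topology F) U \<longleftrightarrow> (None \<in> U \<longrightarrow>
     (\<exists>n. \<forall>k>n. \<forall>m. Some (k, m) \<in> U) \<and> (\<forall>k. \<forall>\<^sub>F m in F. Some (k, m) \<in> U))"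
proof -
  have "istopology (\<lambda>U :: bicyclic0 set. None \<in> U \<longrightarrow>
     (\<exists>n. \<forall>k>n. \<forall>m. Some (k, m) \<in> U) \<and> (\<forall>k. \<forall>\<^sub>F m in F. Some (k, m) \<in> U))"
    (is "istopology ?P")
    unfolding istopology_def
  proof (intro conjI allI impI)
    fix S T assume S: "?P S" and T: "?P T" and 0: "None \<in> S \<inter> T"
    obtain a where a: "\<forall>k>a. \<forall>m. Some (k, m) \<in> S" using S 0 by auto
    obtain b where b: "\<forall>k>b. \<forall>m. Some (k, m) \<in> T" using T 0 by auto
    show "\<exists>n. \<forall>k>n. \<forall>m. Some (k, m) \<in> S \<inter> T"
      using a b by (intro exI[of _ "a + b"]) auto
  next
    fix S T k assume "?P S" "?P T" "None \<in> S \<inter> T"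
    then show "\<forall>\<^sub>F m in F. Some (k, m) \<in> S \<inter> T"
      by (auto simp: eventually_conj_iff)
  next
    fix K assume "\<forall>S\<in>K. ?P S" "None \<in> \<Union>K"
    then obtain S n where "S \<in> K" "\<forall>k>n. \<forall>m. Some (k, m) \<in> S" by blast
    then show "\<exists>n. \<forall>k>n. \<forall>m. Some (k, m) \<in> \<Union>K" by blast
  next
    fix K k assume "\<forall>S\<in>K. ?P S" "None \<in> \<Union>K"
    then obtain S where "S \<in> K" "\<forall>\<^sub>F m in F. Some (k, m) \<in> S" by blast
    then show "\<forall>\<^sub>F m in F. Some (k, m) \<in> \<Union>K"
      by (auto elim: eventually_mono)
  qed
  then show ?thesis
    by (simp add: row_topology_def topology_inverse')
qed

lemma topspace_row_topology: "topspace (row_topology F) = UNIV"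
proof -
  have "openin (row_topology F) UNIV" by (simp add: openin_row_topology)
  then show ?thesis by (simp add: openin_subset top.extremum_uniqueI)
qed

lemma Hausdorff_row_topology:
  assumes "F \<le> sequentially"
  shows "Hausdorff_space (row_topology F)"
proof -
  let ?T = "row_topology F"
  have point: "openin ?T {Some p}" for p by (simp add: openin_row_topology)
  have compl: "openin ?T (- {Some p})" for p
  proof -
    obtain k m where p: "p = (k, m)" by (cases p)
    have "\<forall>\<^sub>F m' in F. m' \<noteq> m"
      using filter_leD[OF assms eventually_gt_at_top[of m]] by (auto elim: eventually_mono)
    then show ?thesis
      unfolding openin_row_topology p
      by (auto intro!: exI[of _ k] elim: eventually_mono)
  qed
  have "\<exists>U V. openin ?T U \<and> openin ?T V \<and> x \<in> U \<and> y \<in> V \<and> disjnt U V" if "x \<noteq> y" for x y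
  proof (cases x)
    case None
    then obtain p where "y = Some p" using \<open>x \<noteq> y\<close> by (cases y) auto
    then show ?thesis
      using None point compl by (intro exI[of _ "- {Some p}"] exI[of _ "{Some p}"]) auto
  next
    case (Some p)
    then show ?thesis
      using point compl \<open>x \<noteq> y\<close> by (intro exI[of _ "{Some p}"] exI[of _ "- {Some p}"]) auto
  qed
  then show ?thesis by (simp add: Hausdorff_space_def)
qed

definition shift_invariant :: "nat filter \<Rightarrow> bool" where
  "shift_invariant F \<longleftrightarrow> (\<forall>i. filterlim (\<lambda>m. m + i) F F \<and> filterlim (\<lambda>m. m - i) F F)"

text \<open>
  Only preimages of neighbourhoods of zero matter, since all other points are isolated.
  Left translation by \<open>(a, b)\<close> sends each row \<open>c \<ge> b\<close> to another row without moving the columns,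
  and maps each of the finitely many rows \<open>c < b\<close> into row \<open>a\<close> by a column shift. Right translation
  by \<open>(a, b)\<close> never decreases the row index, and on the columns beyond \<open>a\<close> it preserves the row
  and shifts the column; a free filter ignores the other columns.
\<close>

lemma shift_continuous_row_topology:
  assumes free: "F \<le> sequentially" and inv: "shift_invariant F"
  shows "shift_continuous (row_topology F)"
proof -
  let ?T = "row_topology F"
  have plus: "\<forall>\<^sub>F m in F. P (m + i)" and minus: "\<forall>\<^sub>F m in F. P (m - i)"
    if "eventually P F" for P i
    using inv that unfolding shift_invariant_def filterlim_iff by auto
  \<comment> \<open>The two features of translations that matter: the row index tends to infinity with the
    original one, uniformly in the column, and each row is mapped \<open>F\<close>-eventually into a single row
    by a column shift.\<close>
  have pre: "openin ?T (f -` U)"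
    if U: "openin ?T U" and f0: "f None = None"
      and far: "\<And>n. \<exists>n'. \<forall>k>n'. \<forall>m. \<exists>k'>n. \<exists>m'. f (Some (k, m)) = Some (k', m')"
      and row: "\<And>k. \<exists>k' i j. \<forall>\<^sub>F m in F. f (Some (k, m)) = Some (k', m + i - j)" for f U
    unfolding openin_row_topology
  proof (intro impI conjI allI)
    assume "None \<in> f -` U"
    then obtain n where n: "\<forall>k>n. \<forall>m. Some (k, m) \<in> U"
      using U f0 by (auto simp: openin_row_topology)
    from far[of n] obtain n' where n': "\<forall>k>n'. \<forall>m. \<exists>k'>n. \<exists>m'. f (Some (k, m)) = Some (k', m')"
      by blast
    have "Some (k, m) \<in> f -` U" if k: "k > n'" for k m
    proof -
      obtain k' m' where "k' > n" "f (Some (k, m)) = Some (k', m')" using n' k by blast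
      then show ?thesis using n by simp
    qed
    then show "\<exists>n. \<forall>k>n. \<forall>m. Some (k, m) \<in> f -` U" by blast
  next
    fix k assume "None \<in> f -` U"
    then have cols: "\<And>k. \<forall>\<^sub>F m in F. Some (k, m) \<in> U"
      using U f0 by (auto simp: openin_row_topology)
    obtain k' i j where "\<forall>\<^sub>F m in F. f (Some (k, m)) = Some (k', m + i - j)" using row by blast
    moreover have "\<forall>\<^sub>F m in F. Some (k', m + i - j) \<in> U"
      using plus[OF minus[OF cols[of k'], of j], of i] .
    ultimately show "\<forall>\<^sub>F m in F. Some (k, m) \<in> f -` U"
      by eventually_elim simp
  qed
  have cont: "continuous_map ?T ?T f" if "\<And>U. openin ?T U \<Longrightarrow> openin ?T (f -` U)" for f
    using that by (simp add: continuous_map_def topspace_row_topology vimage_def)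
  have left: "continuous_map ?T ?T (\<lambda>x. s \<odot> x)" for s
  proof (cases s)
    case None
    then show ?thesis by (simp add: topspace_row_topology)
  next
    case (Some p)
    obtain a b where p: "p = (a, b)" by (cases p)
    show ?thesis unfolding Some p
    proof (rule cont, rule pre)
      show "\<exists>n'. \<forall>k>n'. \<forall>m. \<exists>k'>n. \<exists>m'. Some (a, b) \<odot> Some (k, m) = Some (k', m')" for n
        by (intro exI[of _ "n + b"]) auto
      fix k
      show "\<exists>k' i j. \<forall>\<^sub>F m in F. Some (a, b) \<odot> Some (k, m) = Some (k', m + i - j)"
      proof (cases "b \<le> k")
        case True
        then show ?thesis by (intro exI[of _ "a + k - b"] exI[of _ 0]) simp
      next
        case False
        then show ?thesis by (intro exI[of _ a] exI[of _ b] exI[of _ k]) simp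
      qed
    qed auto
  qed
  have right: "continuous_map ?T ?T (\<lambda>x. x \<odot> s)" for s
  proof (cases s)
    case None
    then have "(\<lambda>x. x \<odot> s) = (\<lambda>x. None)"
      by (metis bicyclic0_mult.simps(2,3) not_None_eq)
    then show ?thesis by (simp add: topspace_row_topology)
  next
    case (Some p)
    obtain a b where p: "p = (a, b)" by (cases p)
    show ?thesis unfolding Some p
    proof (rule cont, rule pre)
      show "\<exists>n'. \<forall>k>n'. \<forall>m. \<exists>k'>n. \<exists>m'. Some (k, m) \<odot> Some (a, b) = Some (k', m')" for n
        by (intro exI[of _ n]) auto
      fix k
      have "\<forall>\<^sub>F m in F. a < m" using free eventually_gt_at_top by (rule filter_leD)
      then show "\<exists>k' i j. \<forall>\<^sub>F m in F. Some (k, m) \<odot> Some (a, b) = Some (k', m + i - j)"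
        by (intro exI[of _ k] exI[of _ b] exI[of _ a]) (auto elim!: eventually_mono)
    qed auto
  qed
  show ?thesis using left right by (simp add: shift_continuous_def)
qed

lemma row_topology_in_weak_SCT:
  assumes "F \<le> sequentially" and "shift_invariant F"
  shows "row_topology F \<in> \<W>"
proof -
  have "row_topology F \<sqsubseteq>\<^sub>t tau_min"
    by (fastforce simp: topology_le_def openin_row_topology openin_tau_min zero_nhd_def)
  then show ?thesis
    using assms Hausdorff_row_topology shift_continuous_row_topology
    by (simp add: weak_SCT_def SCT_def topspace_row_topology)
qed

text \<open>
  The filter is recovered from row \<open>0\<close> of the neighbourhoods of zero. The order is reversed because
  the larger filter on the Isabelle side is the one with fewer large sets.
\<close>

lemma row_topology_le_iff: "row_topology F \<sqsubseteq>\<^sub>t row_topology G \<longleftrightarrow> G \<le> F"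
proof
  assume le: "row_topology F \<sqsubseteq>\<^sub>t row_topology G"
  show "G \<le> F"
  proof (rule filter_leI)
    fix P assume P: "eventually P F"
    let ?U = "- {Some (0, m) | m. \<not> P m}"
    have "\<forall>\<^sub>F m in F. Some (k, m) \<in> ?U" for k
      using P by (auto elim: eventually_mono)
    then have "openin (row_topology F) ?U"
      by (auto simp: openin_row_topology intro!: exI[of _ 0])
    then have "openin (row_topology G) ?U"
      using le by (auto simp: topology_le_def)
    then have "\<forall>\<^sub>F m in G. Some (0, m) \<in> ?U"
      unfolding openin_row_topology by auto
    then show "eventually P G" by simp
  qed
next
  assume "G \<le> F"
  then show "row_topology F \<sqsubseteq>\<^sub>t row_topology G"
    by (auto simp: topology_le_def openin_row_topology dest: filter_leD)
qed

section \<open>A sparse almost disjoint family and its filters\<close>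

definition prefix_code :: "nat set \<Rightarrow> nat \<Rightarrow> nat" where
  "prefix_code Y a = set_encode (insert a (Y \<inter> {..<a}))"

text \<open>Inserting \<open>a\<close> records the length of the prefix, as the largest element of the coded set.\<close>

lemma prefix_code_eq_iff:
  "prefix_code Y a = prefix_code Z b \<longleftrightarrow> a = b \<and> Y \<inter> {..<a} = Z \<inter> {..<a}"
proof
  assume "prefix_code Y a = prefix_code Z b"
  then have eq: "insert a (Y \<inter> {..<a}) = insert b (Z \<inter> {..<b})"
    unfolding prefix_code_def by (subst (asm) set_encode_eq) auto
  have ab: "a = b"
  proof (rule antisym)
    have "a \<in> insert b (Z \<inter> {..<b})" using eq by blast
    then show "a \<le> b" by auto
    have "b \<in> insert a (Y \<inter> {..<a})" using eq by blast
    then show "b \<le> a" by auto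
  qed
  have "Y \<inter> {..<a} = insert a (Y \<inter> {..<a}) - {a}" by auto
  also have "\<dots> = insert b (Z \<inter> {..<b}) - {b}" using eq ab by simp
  also have "\<dots> = Z \<inter> {..<a}" using ab by auto
  finally have "Y \<inter> {..<a} = Z \<inter> {..<a}" .
  with ab show "a = b \<and> Y \<inter> {..<a} = Z \<inter> {..<a}" ..
next
  assume eq: "a = b \<and> Y \<inter> {..<a} = Z \<inter> {..<a}"
  then have "insert a (Y \<inter> {..<a}) = insert b (Z \<inter> {..<b})" by metis
  then show "prefix_code Y a = prefix_code Z b" by (simp only: prefix_code_def)
qed

lemma less_prefix_code: "a < prefix_code Y a"
proof -
  have "a < 2 ^ a" by (rule less_exp)
  also have "\<dots> \<le> prefix_code Y a"
    by (simp add: prefix_code_def set_encode_def)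
  finally show ?thesis .
qed

definition sparse_branch :: "nat set \<Rightarrow> nat set" where
  "sparse_branch Y = range (\<lambda>a. (prefix_code Y a)\<^sup>2)"

lemma squares_far_apart:
  fixes c d k :: nat
  assumes "c \<noteq> d" and "k < c"
  shows "c\<^sup>2 + k < d\<^sup>2 \<or> d\<^sup>2 + k < c\<^sup>2"
proof (cases "c < d")
  case True
  then have "(c + 1)\<^sup>2 \<le> d\<^sup>2" by (intro power_mono) auto
  then show ?thesis using assms(2) by (simp add: power2_eq_square)
next
  case False
  then have "(d + 1)\<^sup>2 \<le> c\<^sup>2" "d + 1 \<le> c" using assms(1) by (auto intro!: power_mono)
  moreover have "c\<^sup>2 \<ge> d\<^sup>2 + c"
  proof -
    obtain e where e: "c = d + 1 + e" using \<open>d + 1 \<le> c\<close> le_Suc_ex by blast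
    show ?thesis unfolding e by (simp add: power2_eq_square algebra_simps)
  qed
  ultimately show ?thesis using assms(2) by linarith
qed

definition far_from_branches :: "nat set set \<Rightarrow> nat \<Rightarrow> nat set" where
  "far_from_branches I k = {m. k < m \<and> (\<forall>Y\<in>I. \<forall>d\<in>sparse_branch Y. m + k < d \<or> d + k < m)}"

text \<open>
  Excluding the \<open>k\<close>-neighbourhood of a branch excludes its shifts by at most \<open>k\<close>. So this is the
  filter generated by the cofinite sets and the complements of all shifts of the branches in \<open>S\<close>.
\<close>

definition branch_filter :: "nat set set \<Rightarrow> nat filter" where
  "branch_filter S =
     (INF (I, k) \<in> {I. finite I \<and> I \<subseteq> S} \<times> UNIV. principal (far_from_branches I k))"

lemma far_from_branches_antimono:
  assumes "I \<subseteq> J" and "k \<le> l"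
  shows "far_from_branches J l \<subseteq> far_from_branches I k"
proof
  fix m assume m: "m \<in> far_from_branches J l"
  have "m + k < d \<or> d + k < m" if "Y \<in> I" "d \<in> sparse_branch Y" for Y d
  proof -
    have "m + l < d \<or> d + l < m" using m that assms(1) by (auto simp: far_from_branches_def)
    then show ?thesis using assms(2) by linarith
  qed
  then show "m \<in> far_from_branches I k" using m assms(2) by (auto simp: far_from_branches_def)
qed

lemma eventually_branch_filter:
  "eventually P (branch_filter S) \<longleftrightarrow>
     (\<exists>I k. finite I \<and> I \<subseteq> S \<and> (\<forall>m\<in>far_from_branches I k. P m))"
proof -
  let ?B = "{I. finite I \<and> I \<subseteq> S} \<times> (UNIV :: nat set)"
  let ?G = "\<lambda>(I, k). principal (far_from_branches I k)"
  have "eventually P (branch_filter S) \<longleftrightarrow> (\<exists>b\<in>?B. eventually P (?G b))"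
    unfolding branch_filter_def
  proof (rule eventually_INF_base)
    show "?B \<noteq> {}" by auto
    fix x y assume "x \<in> ?B" "y \<in> ?B"
    then obtain I k J l where xy: "x = (I, k)" "y = (J, l)" "finite I" "I \<subseteq> S" "finite J" "J \<subseteq> S"
      by auto
    have "?G (I \<union> J, max k l) \<le> inf (?G x) (?G y)"
      using far_from_branches_antimono[of I "I \<union> J" k "max k l"]
        far_from_branches_antimono[of J "I \<union> J" l "max k l"] xy by simp
    moreover have "(I \<union> J, max k l) \<in> ?B" using xy by simp
    ultimately show "\<exists>z\<in>?B. ?G z \<le> inf (?G x) (?G y)" by blast
  qed
  then show ?thesis by (auto simp: eventually_principal)
qed

lemma branch_filter_le_sequentially: "branch_filter S \<le> sequentially"
proof (rule filter_leI)
  fix P :: "nat \<Rightarrow> bool" assume "eventually P sequentially"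
  then obtain n where "\<forall>m\<ge>n. P m" by (auto simp: eventually_sequentially)
  then show "eventually P (branch_filter S)"
    unfolding eventually_branch_filter
    by (intro exI[of _ "{}"] exI[of _ n]) (auto simp: far_from_branches_def)
qed

lemma shift_invariant_branch_filter: "shift_invariant (branch_filter S)"
proof -
  have far: "m + i \<in> far_from_branches I k" "m - i \<in> far_from_branches I k"
    if "m \<in> far_from_branches I (k + i)" for m i k I
  proof -
    have k: "k + i < m" using that by (simp add: far_from_branches_def)
    have "(m + i) + k < d \<or> d + k < m + i" "(m - i) + k < d \<or> d + k < m - i"
      if d: "Y \<in> I" "d \<in> sparse_branch Y" for Y d
    proof -
      have "m + (k + i) < d \<or> d + (k + i) < m"
        using \<open>m \<in> far_from_branches I (k + i)\<close> d by (auto simp: far_from_branches_def)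
      then show "(m + i) + k < d \<or> d + k < m + i" "(m - i) + k < d \<or> d + k < m - i"
        by linarith+
    qed
    then show "m + i \<in> far_from_branches I k" "m - i \<in> far_from_branches I k"
      using k by (simp_all add: far_from_branches_def)
  qed
  have "eventually (\<lambda>m. P (m + i)) (branch_filter S) \<and> eventually (\<lambda>m. P (m - i)) (branch_filter S)"
    if P: "eventually P (branch_filter S)" for P i
  proof -
    obtain I k where I: "finite I" "I \<subseteq> S" "\<forall>m\<in>far_from_branches I k. P m"
      using P by (auto simp: eventually_branch_filter)
    then have "\<forall>m\<in>far_from_branches I (k + i). P (m + i) \<and> P (m - i)"
      using far by blast
    then show ?thesis
      unfolding eventually_branch_filter using I(1,2) by metis
  qed
  then show ?thesis by (auto simp: shift_invariant_def filterlim_iff)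
qed

text \<open>
  A point of the branch of \<open>Z\<close> coding a prefix that is long enough to distinguish \<open>Z\<close> from every
  member of \<open>I\<close> is a square different from all points on the branches in \<open>I\<close>, hence far
  from them once it is large.
\<close>

lemma branch_meets_far_from_branches:
  assumes "finite I" and "Z \<notin> I"
  shows "sparse_branch Z \<inter> far_from_branches I k \<noteq> {}"
proof -
  have "\<exists>b. (b \<in> Y) \<noteq> (b \<in> Z)" if "Y \<in> I" for Y
    using that assms(2) by (metis subsetI subset_antisym)
  then obtain b where b: "\<And>Y. Y \<in> I \<Longrightarrow> (b Y \<in> Y) \<noteq> (b Y \<in> Z)" by metis
  obtain l where l: "\<And>Y. Y \<in> I \<Longrightarrow> b Y \<le> l"
    using assms(1) finite_nat_set_iff_bounded_le[of "b ` I"] by auto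
  define a where "a = Suc (max k l)"
  define c where "c = prefix_code Z a"
  have kc: "k < c" using less_prefix_code[of a Z] by (simp add: c_def a_def)
  have "c\<^sup>2 + k < d \<or> d + k < c\<^sup>2" if Y: "Y \<in> I" and d: "d \<in> sparse_branch Y" for Y d
  proof -
    obtain a' where a': "d = (prefix_code Y a')\<^sup>2" using d by (auto simp: sparse_branch_def)
    have "b Y < a" using l[OF Y] by (simp add: a_def)
    then have "Z \<inter> {..<a} \<noteq> Y \<inter> {..<a}" using b[OF Y] by blast
    then have "c \<noteq> prefix_code Y a'" by (simp add: c_def prefix_code_eq_iff)
    then show ?thesis unfolding a' using kc by (rule squares_far_apart)
  qed
  moreover have "k < c\<^sup>2" using kc by (simp add: power2_eq_square) (metis le_square less_le_trans)
  ultimately have "c\<^sup>2 \<in> far_from_branches I k" by (auto simp: far_from_branches_def)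
  then show ?thesis by (auto simp: sparse_branch_def c_def)
qed

lemma branch_filter_le_iff: "branch_filter T \<le> branch_filter S \<longleftrightarrow> S \<subseteq> T"
proof
  assume sub: "S \<subseteq> T"
  show "branch_filter T \<le> branch_filter S"
  proof (rule filter_leI)
    fix P assume "eventually P (branch_filter S)"
    then obtain I k where "finite I" "I \<subseteq> S" "\<forall>m\<in>far_from_branches I k. P m"
      by (auto simp: eventually_branch_filter)
    moreover from this have "I \<subseteq> T" using sub by blast
    ultimately show "eventually P (branch_filter T)"
      unfolding eventually_branch_filter by blast
  qed
next
  assume le: "branch_filter T \<le> branch_filter S"
  show "S \<subseteq> T"
  proof
    fix Z assume "Z \<in> S"
    have "\<forall>m\<in>far_from_branches {Z} 0. m \<notin> sparse_branch Z"
      by (fastforce simp: far_from_branches_def)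
    moreover have "finite {Z}" "{Z} \<subseteq> S" using \<open>Z \<in> S\<close> by auto
    ultimately have "\<forall>\<^sub>F m in branch_filter S. m \<notin> sparse_branch Z"
      unfolding eventually_branch_filter by blast
    with le have "\<forall>\<^sub>F m in branch_filter T. m \<notin> sparse_branch Z"
      by (rule filter_leD)
    then obtain I k where "finite I" "I \<subseteq> T" "\<forall>m\<in>far_from_branches I k. m \<notin> sparse_branch Z"
      by (auto simp: eventually_branch_filter)
    then show "Z \<in> T" using branch_meets_far_from_branches[of I Z k] by blast
  qed
qed

section \<open>Antichains, chains and cardinalities\<close>

definition weak_topology :: "nat set set \<Rightarrow> bicyclic0 topology" where
  "weak_topology S = row_topology (branch_filter S)"

lemma weak_topology_in_weak_SCT: "weak_topology S \<in> \<W>"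
  unfolding weak_topology_def
  by (intro row_topology_in_weak_SCT branch_filter_le_sequentially shift_invariant_branch_filter)

lemma weak_topology_le_iff: "weak_topology S \<sqsubseteq>\<^sub>t weak_topology T \<longleftrightarrow> S \<subseteq> T"
  by (simp add: weak_topology_def row_topology_le_iff branch_filter_le_iff)

lemma inj_weak_topology: "inj weak_topology"
  by (rule injI) (metis weak_topology_le_iff subset_antisym subset_refl)

text \<open>
  The sets containing \<open>0\<close> and those not containing \<open>0\<close> are two copies of the power set of \<open>\<nat>\<close>;
  the new set is \<open>S\<close> in the former and the complement of \<open>S\<close> in the latter.
\<close>

definition with_complement :: "nat set set \<Rightarrow> nat set set" where
  "with_complement S = {Y. (0 \<in> Y) = ({m. Suc m \<in> Y} \<in> S)}"

lemma with_complement_subset_iff: "with_complement S \<subseteq> with_complement T \<longleftrightarrow> S = T"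
proof
  assume sub: "with_complement S \<subseteq> with_complement T"
  have "Z \<in> S \<longleftrightarrow> Z \<in> T" for Z
  proof (cases "Z \<in> S")
    case True
    then have "insert 0 (Suc ` Z) \<in> with_complement S" by (simp add: with_complement_def image_iff)
    then have "insert 0 (Suc ` Z) \<in> with_complement T" using sub by blast
    then show ?thesis using True by (simp add: with_complement_def image_iff)
  next
    case False
    then have "Suc ` Z \<in> with_complement S" by (simp add: with_complement_def image_iff)
    then have "Suc ` Z \<in> with_complement T" using sub by blast
    then show ?thesis using False by (simp add: with_complement_def image_iff)
  qed
  then show "S = T" by blast
qed simp

lemma weak_SCT_antichain:
  "\<exists>A. A \<subseteq> \<W> \<and> topology_antichain A \<and> A \<approx> pow_continuum"
proof -
  define f where "f S = weak_topology (with_complement S)" for S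
  have le: "f S \<sqsubseteq>\<^sub>t f T \<longleftrightarrow> S = T" for S T
    by (simp add: f_def weak_topology_le_iff with_complement_subset_iff)
  have "inj f" by (rule injI) (metis le)
  moreover have "pow_continuum = UNIV" by (auto simp: pow_continuum_def continuum_def)
  ultimately have "range f \<approx> pow_continuum" by (simp add: inj_on_image_eqpoll_self)
  moreover have "range f \<subseteq> \<W>" by (auto simp: f_def weak_topology_in_weak_SCT)
  moreover have "topology_antichain (range f)" by (auto simp: topology_antichain_def le)
  ultimately show ?thesis by blast
qed

lemma weak_SCT_well_ordered_chain:
  "\<exists>A. A \<subseteq> \<W> \<and> topology_well_ordered_chain A \<and> A \<approx> continuum"
proof -
  obtain r :: "nat set rel" where r: "well_order_on UNIV r" using well_order_on by blast
  then have refl: "refl r" and trans: "trans r" and anti: "antisym r"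
    by (auto simp: order_on_defs)
  have fld: "Field r = UNIV" using well_order_on_Well_order[OF r] by simp
  define f where "f y = weak_topology {x. (x, y) \<in> r}" for y
  have le: "f x \<sqsubseteq>\<^sub>t f y \<longleftrightarrow> (x, y) \<in> r" for x y
    unfolding f_def weak_topology_le_iff
    using refl trans by (auto dest: transD reflD)
  have inj: "inj f"
    by (rule injI) (metis le refl anti antisymD reflD)
  have img: "dir_image r f = {(S, T). S \<in> range f \<and> T \<in> range f \<and> S \<sqsubseteq>\<^sub>t T}"
    by (auto simp: dir_image_def le) (metis le)
  have "Well_order (dir_image r f)"
    using r inj by (intro Well_order_dir_image) (auto simp: fld)
  then have "topology_well_ordered_chain (range f)"
    by (simp add: topology_well_ordered_chain_def dir_image_Field fld flip: img)
  moreover have "range f \<approx> continuum"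
    using inj by (simp add: inj_on_image_eqpoll_self continuum_def)
  moreover have "range f \<subseteq> \<W>" by (auto simp: f_def weak_topology_in_weak_SCT)
  ultimately show ?thesis by blast
qed

lemma topologies_lepoll_pow_continuum: "(A :: 'a::countable topology set) \<lesssim> pow_continuum"
proof -
  define f :: "'a topology \<Rightarrow> nat set set" where
    "f T = (\<lambda>U. to_nat ` U) ` {U. openin T U}" for T
  have img: "inj ((`) (to_nat :: 'a \<Rightarrow> nat))" by (simp add: inj_image_eq_iff inj_def)
  have "inj f"
  proof (rule injI)
    fix S T assume "f S = f T"
    then have "{U. openin S U} = {U. openin T U}"
      using img by (simp add: f_def inj_image_eq_iff)
    then show "S = T" by (auto simp: topology_eq)
  qed
  then show ?thesis
    unfolding lepoll_def pow_continuum_def continuum_def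
    by (intro exI[of _ f]) (auto intro: inj_on_subset)
qed

theorem theorem2p5:
  shows "(\<exists>A. A \<subseteq> \<W> \<and> topology_antichain A \<and> A \<approx> pow_continuum) \<and>
         (\<exists>A. A \<subseteq> \<W> \<and> topology_well_ordered_chain A \<and> A \<approx> continuum) \<and>
         (\<W> \<approx> SCT \<and> SCT \<approx> pow_continuum)"
proof -
  obtain A where A: "A \<subseteq> \<W>" "A \<approx> pow_continuum" using weak_SCT_antichain by blast
  have lower: "pow_continuum \<lesssim> \<W>"
    using A by (meson eqpoll_imp_lepoll eqpoll_sym lepoll_trans subset_imp_lepoll)
  have sub: "\<W> \<lesssim> SCT" by (rule subset_imp_lepoll) (auto simp: weak_SCT_def)
  have upper: "SCT \<lesssim> pow_continuum" by (rule topologies_lepoll_pow_continuum)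
  have "\<W> \<approx> SCT" using sub lepoll_trans[OF upper lower] by (rule lepoll_antisym)
  moreover have "SCT \<approx> pow_continuum"
    using upper lepoll_trans[OF lower sub] by (rule lepoll_antisym)
  ultimately show ?thesis
    using weak_SCT_antichain weak_SCT_well_ordered_chain by blast
qed

end
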